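(* Let $n \geq 2$ and $k \geq 3$ be integers and let $m \geq k\,\alpha_k(B_n)$ be an integer. Let $w$ and $w'$ be $m$-weightings of $B_n$ such that $w$ is uniform-$\alpha$ and $w'$ is uniform on a largest $k$-clique independent set of $B_n$. Then $\pi_k(B_n(w)) < \pi_k(B_n(w'))$.
   Context: All graphs are simple. $\mathbb{N}_0 = \{0,1,2,\dots\}$, $[n]=\{1,\dots,n\}$. For a graph $G$, a function $w: V(G) \to \mathbb{N}_0$ with $\sum_{v \in V(G)} w(v) = m$ is an $m$-weighting of $G$. $G(w)$ is the graph obtained from $G$ by replacing each vertex $v$ by a clique $K^v$ on $w(v)$ vertices and joining every vertex of $K^u$ to every vertex of $K^v$ whenever $uv \in E(G)$. $\pi_k(H)$ denotes the number of $k$-cliques of a graph $H$. A subset $I \subseteq V(G)$ is a $k$-clique independent set if no $k$ vertices of $I$ induce a $k$-clique of $G$; $\alpha_k(G)$ is the maximum size of a $k$-clique independent set. An $m$-weighting $w$ is uniform on $U \subseteq V(G)$ if $w(v)=0$ for all $v \notin U$ and $w(u) \in \{\lfloor m/|U|\rfloor, \lceil m/|U| \rceil\}$ for all $u \in U$; $w$ is uniform-$\alpha$ if it is uniform on some independent set of $G$ of maximum size. The Sperner graph $B_n$ has vertex set $2^{[n]}$ and edges $XY$ for all $X \subsetneq Y \subseteq [n]$. *)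

theory Defs
  imports Complex_Main
begin

record 'a graph =
  verts :: "'a set"
  edges :: "'a set set"

definition simple_graph :: "'a graph \<Rightarrow> bool" where
  "simple_graph G \<longleftrightarrow> (\<forall>e\<in>edges G. e \<subseteq> verts G \<and> card e = 2)"

definition weighting :: "'a graph \<Rightarrow> nat \<Rightarrow> ('a \<Rightarrow> nat) \<Rightarrow> bool" where
  "weighting G m w \<longleftrightarrow> (\<Sum>v\<in>verts G. w v) = m"

(* The clique replacing v is {(v, i) | i < w v}. *)
definition blowup :: "'a graph \<Rightarrow> ('a \<Rightarrow> nat) \<Rightarrow> ('a \<times> nat) graph" where
  "blowup G w =
    (let V = (SIGMA v : verts G. {..<w v}) in
     \<lparr>verts = V,
      edges = {{(u, i), (v, j)} | u i v j.
        (u, i) \<in> V \<and> (v, j) \<in> V \<and> ((u = v \<and> i \<noteq> j) \<or> {u, v} \<in> edges G)}\<rparr>)"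

definition is_clique :: "nat \<Rightarrow> 'a graph \<Rightarrow> 'a set \<Rightarrow> bool" where
  "is_clique k G K \<longleftrightarrow> K \<subseteq> verts G \<and> finite K \<and> card K = k \<and>
     (\<forall>x\<in>K. \<forall>y\<in>K. x \<noteq> y \<longrightarrow> {x, y} \<in> edges G)"

definition num_cliques :: "nat \<Rightarrow> 'a graph \<Rightarrow> nat" where
  "num_cliques k G = card {K. is_clique k G K}"

definition independent_set :: "'a graph \<Rightarrow> 'a set \<Rightarrow> bool" where
  "independent_set G I \<longleftrightarrow> I \<subseteq> verts G \<and> (\<forall>x\<in>I. \<forall>y\<in>I. {x, y} \<notin> edges G)"

definition clique_independent :: "nat \<Rightarrow> 'a graph \<Rightarrow> 'a set \<Rightarrow> bool" where
  "clique_independent k G I \<longleftrightarrow> I \<subseteq> verts G \<and> (\<forall>K\<subseteq>I. \<not> is_clique k G K)"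

definition alpha :: "'a graph \<Rightarrow> nat" where
  "alpha G = Max (card ` {I. independent_set G I})"

definition clique_alpha :: "nat \<Rightarrow> 'a graph \<Rightarrow> nat" where
  "clique_alpha k G = Max (card ` {I. clique_independent k G I})"

definition uniform_on :: "'a graph \<Rightarrow> nat \<Rightarrow> ('a \<Rightarrow> nat) \<Rightarrow> 'a set \<Rightarrow> bool" where
  "uniform_on G m w U \<longleftrightarrow> U \<subseteq> verts G \<and>
     (\<forall>v\<in>verts G - U. w v = 0) \<and>
     (\<forall>u\<in>U. int (w u) \<in> {\<lfloor>real m / real (card U)\<rfloor>, \<lceil>real m / real (card U)\<rceil>})"

definition uniform_alpha :: "'a graph \<Rightarrow> nat \<Rightarrow> ('a \<Rightarrow> nat) \<Rightarrow> bool" where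
  "uniform_alpha G m w \<longleftrightarrow>
     (\<exists>I. independent_set G I \<and> card I = alpha G \<and> uniform_on G m w I)"

definition sperner_graph :: "nat \<Rightarrow> nat set graph" where
  "sperner_graph n =
     \<lparr>verts = Pow {1..n}, edges = {{X, Y} | X Y. X \<subset> Y \<and> Y \<subseteq> {1..n}}\<rparr>"

lemma finite_verts_sperner_graph: "finite (verts (sperner_graph n))"
  by (simp add: sperner_graph_def)

lemma simple_graph_sperner_graph: "simple_graph (sperner_graph n)"
  by (auto simp: simple_graph_def sperner_graph_def card_insert_if)

lemma simple_graph_blowup:
  assumes "simple_graph G"
  shows "simple_graph (blowup G w)"
proof -
  have "u \<noteq> v" if "{u, v} \<in> edges G" for u v
    using that assms by (force simp: simple_graph_def)
  then show ?thesis
    by (fastforce simp: simple_graph_def blowup_def Let_def card_insert_if)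
qed

end

theory Submission
  imports Defs "HOL-Combinatorics.Transposition"
begin

text \<open>
  By Dilworth's theorem the Boolean lattice splits into at most \<open>\<alpha>(B\<^sub>n)\<close> chains. The
  \<open>k\<close>-subsets of the blow-up of a single chain are cliques, so \<open>\<pi>\<^sub>k(B\<^sub>n(w'))\<close> is at least
  the sum of \<open>w'(C) choose k\<close> over these chains \<open>C\<close>; by convexity this is at least its
  value for a balanced distribution of \<open>m\<close> over \<open>\<alpha>(B\<^sub>n)\<close> parts, which is \<open>\<pi>\<^sub>k(B\<^sub>n(w))\<close>.

  For strictness it suffices to find \<open>X \<subset> Y\<close> in \<open>U\<close> lying in different chains, since then
  some clique meets both blown-up vertices. Maximality of \<open>U\<close> provides a
  comparable pair other than \<open>\<emptyset> \<subset> [n]\<close>; a transposition of \<open>[n]\<close> that fixes one member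
  of the pair and moves the other turns a chain decomposition joining \<open>X\<close> to \<open>Y\<close> into one
  that separates them.
\<close>

section \<open>Chain partitions, antichains and Dilworth's theorem\<close>

definition antichain_in :: "'a::order set \<Rightarrow> 'a set \<Rightarrow> bool" where
  "antichain_in S A \<longleftrightarrow> A \<subseteq> S \<and> (\<forall>x\<in>A. \<forall>y\<in>A. x \<le> y \<longrightarrow> x = y)"

text \<open>This encodes a partition into at most \<open>r\<close> chains, since colour classes may
  be empty. As a function it can be composed with an automorphism of the order, and its fibres index
  sums of weights.\<close>

definition chain_colouring :: "'a::order set \<Rightarrow> nat \<Rightarrow> ('a \<Rightarrow> nat) \<Rightarrow> bool" where
  "chain_colouring S r c \<longleftrightarrow> (\<forall>x\<in>S. c x < r) \<and>
     (\<forall>x\<in>S. \<forall>y\<in>S. c x = c y \<longrightarrow> x \<le> y \<or> y \<le> x)"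

lemma antichain_in_mono: "antichain_in S A \<Longrightarrow> S \<subseteq> T \<Longrightarrow> antichain_in T A"
  by (auto simp: antichain_in_def)

lemma chain_colouring_inj_on_antichain:
  assumes "chain_colouring S r c" "antichain_in S A"
  shows "inj_on c A"
  using assms unfolding chain_colouring_def antichain_in_def inj_on_def by blast

lemma chain_colouring_card_antichain_le:
  assumes "chain_colouring S r c" "antichain_in S A"
  shows "card A \<le> r"
proof -
  have "c ` A \<subseteq> {..<r}"
    using assms by (auto simp: chain_colouring_def antichain_in_def)
  then show ?thesis
    using chain_colouring_inj_on_antichain[OF assms]
    by (metis card_image card_lessThan card_mono finite_lessThan)
qed

lemma chain_colouring_image_maximum_antichain:
  assumes "chain_colouring S r c" "antichain_in S A" "card A = r"
  shows "c ` A = {..<r}"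
proof (rule card_subset_eq)
  show "c ` A \<subseteq> {..<r}"
    using assms by (auto simp: chain_colouring_def antichain_in_def)
  show "card (c ` A) = card {..<r}"
    using chain_colouring_inj_on_antichain[OF assms(1,2)] assms(3) by (simp add: card_image)
qed simp

text \<open>Galvin's proof of Dilworth's theorem.\<close>

theorem dilworth:
  fixes S :: "'a::order set"
  assumes "finite S"
  shows "\<exists>A c. antichain_in S A \<and> chain_colouring S (card A) c"
  using assms
proof (induction S rule: finite_psubset_induct)
  case (psubset S)
  show ?case
  proof (cases "S = {}")
    case True
    then show ?thesis
      by (auto simp: antichain_in_def chain_colouring_def)
  next
    case False
    obtain a where a: "a \<in> S" and amax: "\<And>b. b \<in> S \<Longrightarrow> a \<le> b \<Longrightarrow> a = b"
      using finite_has_maximal[OF psubset.hyps(1) False] by blast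
    define S' where "S' = S - {a}"
    have S'sub: "S' \<subset> S" and aS': "a \<notin> S'"
      using a by (auto simp: S'_def)
    have finS': "finite S'"
      using psubset.hyps(1) by (simp add: S'_def)
    obtain A c where A: "antichain_in S' A" and c: "chain_colouring S' (card A) c"
      using psubset.IH[OF S'sub] by blast
    define r where "r = card A"
    note c = c[folded r_def]
    \<comment> \<open>The elements that lie on some antichain of the maximum size \<open>r\<close>
      in \<open>S'\<close>.\<close>
    define M where "M = {z. \<exists>B. antichain_in S' B \<and> card B = r \<and> z \<in> B}"
    have MS': "M \<subseteq> S'"
      by (auto simp: M_def antichain_in_def)
    \<comment> \<open>\<open>A\<close> lies in \<open>M\<close> and meets every colour; the part of
      a colour class inside \<open>M\<close> is a finite nonempty chain, so it has a greatest
      element.\<close>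
    have top: "\<exists>z. z \<in> M \<and> c z = i \<and> (\<forall>y\<in>M. c y = i \<longrightarrow> y \<le> z)" if i: "i < r" for i
    proof -
      let ?N = "{z \<in> M. c z = i}"
      have "i \<in> c ` A"
        using chain_colouring_image_maximum_antichain[OF c A] i by (simp add: r_def)
      then have "?N \<noteq> {}"
        using A by (auto simp: M_def r_def)
      moreover have "finite ?N"
        using MS' finS' by (auto intro: finite_subset)
      ultimately obtain z where z: "z \<in> ?N" and zmax: "\<And>y. y \<in> ?N \<Longrightarrow> z \<le> y \<Longrightarrow> z = y"
        using finite_has_maximal[of ?N] by blast
      have "y \<le> z" if "y \<in> M" "c y = i" for y
      proof -
        have "y \<le> z \<or> z \<le> y"
          using c z that MS' unfolding chain_colouring_def by (metis (mono_tags, lifting) mem_Collect_eq subsetD)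
        then show ?thesis
          using zmax[of y] that by auto
      qed
      then show ?thesis
        using z by blast
    qed
    define x where "x i = (SOME z. z \<in> M \<and> c z = i \<and> (\<forall>y\<in>M. c y = i \<longrightarrow> y \<le> z))" for i
    have x: "x i \<in> M" "c (x i) = i" "\<And>y. y \<in> M \<Longrightarrow> c y = i \<Longrightarrow> y \<le> x i" if "i < r" for i
      using someI_ex[OF top[OF that]] by (auto simp: x_def)
    \<comment> \<open>An \<open>r\<close>-antichain through \<open>x i\<close> also has an element
      \<open>y\<close> of colour \<open>j\<close>, and \<open>y \<le> x j \<le> x i\<close> would
      make two of its elements comparable.\<close>
    have x_incomparable: "\<not> x j \<le> x i" if ij: "i < r" "j < r" "i \<noteq> j" for i j
    proof
      assume le: "x j \<le> x i"
      obtain B where B: "antichain_in S' B" "card B = r" "x i \<in> B"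
        using x(1)[OF ij(1)] by (auto simp: M_def)
      then obtain y where y: "y \<in> B" "c y = j"
        using chain_colouring_image_maximum_antichain[OF c B(1,2)] ij(2) by (metis imageE lessThan_iff)
      have "y \<in> M"
        using B y by (auto simp: M_def)
      then have "y \<le> x i"
        using order_trans[OF x(3)[OF ij(2) _ y(2)] le] by blast
      then have "y = x i"
        using B y by (auto simp: antichain_in_def)
      then show False
        using y(2) x(2)[OF ij(1)] ij(3) by simp
    qed
    show ?thesis
    proof (cases "\<exists>i<r. x i \<le> a")
      case True
      then obtain i where i: "i < r" "x i \<le> a"
        by blast
      \<comment> \<open>Removing this chain destroys every \<open>r\<close>-antichain of
        \<open>S'\<close>: its element of colour \<open>i\<close> lies in \<open>M\<close>, hence
        below \<open>x i\<close>, hence in \<open>K\<close>.\<close>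
      define K where "K = insert a {z \<in> S'. c z = i \<and> z \<le> x i}"
      have K_chain: "u \<le> v \<or> v \<le> u" if "u \<in> K" "v \<in> K" for u v
        using that c i(2) unfolding K_def chain_colouring_def by (auto intro: order_trans)
      have "S - K \<subset> S"
        using a by (auto simp: K_def)
      then obtain B d where B: "antichain_in (S - K) B" and d: "chain_colouring (S - K) (card B) d"
        using psubset.IH by blast
      have B': "antichain_in S' B"
        by (rule antichain_in_mono[OF B]) (auto simp: K_def S'_def)
      have "card B \<noteq> r"
      proof
        assume card_B: "card B = r"
        then obtain y where y: "y \<in> B" "c y = i"
          using chain_colouring_image_maximum_antichain[OF c B'] i(1) by (metis imageE lessThan_iff)
        then have "y \<in> M"
          using B' card_B by (auto simp: M_def)
        then have "y \<in> K"
          using x(3)[OF i(1)] y MS' by (auto simp: K_def)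
        then show False
          using y(1) B by (auto simp: antichain_in_def)
      qed
      then have card_B: "card B < r"
        using chain_colouring_card_antichain_le[OF c B'] by simp
      \<comment> \<open>The colours of \<open>d\<close> are below \<open>card B\<close>, which is at
        most \<open>r - 1\<close>, so \<open>r - 1\<close> is free for \<open>K\<close>.\<close>
      have "chain_colouring S r (\<lambda>z. if z \<in> K then r - 1 else d z)"
        unfolding chain_colouring_def
      proof (intro conjI ballI impI)
        fix u assume "u \<in> S"
        then show "(if u \<in> K then r - 1 else d u) < r"
          using d card_B by (force simp: chain_colouring_def)
      next
        fix u v
        assume uv: "u \<in> S" "v \<in> S"
          "(if u \<in> K then r - 1 else d u) = (if v \<in> K then r - 1 else d v)"
        have "d z < r - 1" if "z \<in> S" "z \<notin> K" for z
          using d card_B that by (force simp: chain_colouring_def)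
        then have "(u \<in> K \<and> v \<in> K) \<or> (u \<notin> K \<and> v \<notin> K \<and> d u = d v)"
          using uv by (metis less_irrefl)
        then show "u \<le> v \<or> v \<le> u"
          using K_chain d uv(1,2) unfolding chain_colouring_def by blast
      qed
      moreover have "antichain_in S A"
        using antichain_in_mono[OF A] S'sub by blast
      ultimately show ?thesis
        unfolding r_def by blast
    next
      case False
      \<comment> \<open>As \<open>a\<close> is maximal and lies above no \<open>x i\<close>, it
        extends the antichain of the \<open>x i\<close> to size \<open>r + 1\<close>, which pays for
        giving \<open>a\<close> a colour of its own.\<close>
      let ?B = "insert a (x ` {..<r})"
      have xS': "x i \<in> S'" if "i < r" for i
        using x(1)[OF that] MS' by blast
      have "inj_on x {..<r}"
        using x(2) by (metis inj_onI lessThan_iff)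
      moreover have "a \<notin> x ` {..<r}"
        using xS' aS' by auto
      ultimately have card_B: "card ?B = Suc r"
        by (simp add: card_image)
      have "antichain_in S ?B"
        unfolding antichain_in_def
      proof (intro conjI ballI impI)
        show "?B \<subseteq> S"
          using a xS' S'sub by auto
      next
        fix u v assume uv: "u \<in> ?B" "v \<in> ?B" "u \<le> v"
        show "u = v"
        proof (cases "u = a")
          case True
          then show ?thesis
            using amax uv xS' S'sub by auto
        next
          case False
          then obtain i where i: "i < r" "u = x i"
            using uv(1) by auto
          then have "v \<noteq> a"
            using uv(3) \<open>\<not> (\<exists>i<r. x i \<le> a)\<close> by blast
          then obtain j where "j < r" "v = x j"
            using uv(2) by auto
          then show ?thesis
            using i uv(3) x_incomparable by blast
        qed
      qed
      moreover have "chain_colouring S (card ?B) (\<lambda>z. if z = a then r else c z)"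
        using c unfolding card_B chain_colouring_def S'_def
        by (auto simp: less_Suc_eq)
      ultimately show ?thesis
        by blast
    qed
  qed
qed

section \<open>Counting cliques in blow-ups\<close>

lemma card_Sigma_subsets_of_size:
  fixes w :: "'a \<Rightarrow> nat"
  assumes "finite V"
  shows "card {K. K \<subseteq> (SIGMA v:V. {..<w v}) \<and> card K = k} = (\<Sum>v\<in>V. w v) choose k"
  using assms by (subst n_subsets) auto

text \<open>Distinct copies of one vertex are always adjacent, so only pairs with different base
  vertices impose a condition.\<close>

lemma is_clique_blowup_iff:
  assumes "simple_graph G"
  shows "is_clique k (blowup G w) K \<longleftrightarrow>
    K \<subseteq> (SIGMA v:verts G. {..<w v}) \<and> finite K \<and> card K = k \<and>
    (\<forall>x\<in>K. \<forall>y\<in>K. fst x \<noteq> fst y \<longrightarrow> {fst x, fst y} \<in> edges G)"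
proof -
  let ?V = "SIGMA v:verts G. {..<w v}"
  have adj: "{x, y} \<in> edges (blowup G w) \<longleftrightarrow> (fst x \<noteq> fst y \<longrightarrow> {fst x, fst y} \<in> edges G)"
    if xy: "x \<in> ?V" "y \<in> ?V" "x \<noteq> y" for x y
  proof
    assume "{x, y} \<in> edges (blowup G w)"
    then obtain u i v j where e: "{x, y} = {(u, i), (v, j)}"
      "(u = v \<and> i \<noteq> j) \<or> {u, v} \<in> edges G"
      by (auto simp: blowup_def Let_def)
    then show "fst x \<noteq> fst y \<longrightarrow> {fst x, fst y} \<in> edges G"
      by (auto simp: doubleton_eq_iff insert_commute)
  next
    assume "fst x \<noteq> fst y \<longrightarrow> {fst x, fst y} \<in> edges G"
    then show "{x, y} \<in> edges (blowup G w)"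
      using xy unfolding blowup_def Let_def
      by (cases x; cases y) auto
  qed
  have vs: "verts (blowup G w) = ?V"
    by (simp add: blowup_def Let_def)
  show ?thesis
    unfolding is_clique_def vs
  proof (intro conj_cong refl)
    assume K: "K \<subseteq> ?V"
    show "(\<forall>x\<in>K. \<forall>y\<in>K. x \<noteq> y \<longrightarrow> {x, y} \<in> edges (blowup G w)) \<longleftrightarrow>
      (\<forall>x\<in>K. \<forall>y\<in>K. fst x \<noteq> fst y \<longrightarrow> {fst x, fst y} \<in> edges G)"
    proof (intro ball_cong refl)
      fix x y assume "x \<in> K" "y \<in> K"
      then show "(x \<noteq> y \<longrightarrow> {x, y} \<in> edges (blowup G w)) \<longleftrightarrow>
        (fst x \<noteq> fst y \<longrightarrow> {fst x, fst y} \<in> edges G)"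
        using adj[of x y] K by (cases "x = y") auto
    qed
  qed
qed

lemma finite_cliques: "finite (verts G) \<Longrightarrow> finite {K. is_clique k G K}"
  by (rule finite_subset[of _ "Pow (verts G)"]) (auto simp: is_clique_def)

text \<open>All base vertices of a clique lie in \<open>I\<close> and are pairwise equal or
  adjacent, so independence forces a single base vertex.\<close>

lemma num_cliques_blowup_independent_le:
  assumes "simple_graph G" "finite (verts G)" "independent_set G I"
    and "\<forall>v\<in>verts G - I. w v = 0" and "k \<ge> 1"
  shows "num_cliques k (blowup G w) \<le> (\<Sum>v\<in>I. w v choose k)"
proof -
  have finI: "finite I" and IV: "I \<subseteq> verts G"
    using assms(2,3) by (auto simp: independent_set_def intro: finite_subset)
  let ?F = "\<lambda>v. {K. K \<subseteq> (SIGMA u:{v}. {..<w u}) \<and> card K = k}"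
  have finF: "finite (?F v)" for v
    by (rule finite_subset[of _ "Pow (SIGMA u:{v}. {..<w u})"]) auto
  have "{K. is_clique k (blowup G w) K} \<subseteq> (\<Union>v\<in>I. ?F v)"
  proof
    fix K assume "K \<in> {K. is_clique k (blowup G w) K}"
    then have K: "K \<subseteq> (SIGMA v:verts G. {..<w v})" "finite K" "card K = k"
      "\<forall>x\<in>K. \<forall>y\<in>K. fst x \<noteq> fst y \<longrightarrow> {fst x, fst y} \<in> edges G"
      by (auto simp: is_clique_blowup_iff[OF assms(1)])
    have inI: "fst x \<in> I" if "x \<in> K" for x
      using that K(1) assms(4) by force
    obtain x where x: "x \<in> K"
      using K(3) assms(5) by (cases "K = {}") auto
    have "fst y = fst x" if "y \<in> K" for y
      using K(4) x that inI assms(3) unfolding independent_set_def by blast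
    then have "K \<subseteq> (SIGMA u:{fst x}. {..<w u})"
      using K(1) by fastforce
    then show "K \<in> (\<Union>v\<in>I. ?F v)"
      using inI[OF x] K(3) by blast
  qed
  then have "num_cliques k (blowup G w) \<le> card (\<Union>v\<in>I. ?F v)"
    unfolding num_cliques_def using finI finF by (intro card_mono) auto
  also have "\<dots> \<le> (\<Sum>v\<in>I. card (?F v))"
    by (rule card_UN_le[OF finI])
  also have "\<dots> = (\<Sum>v\<in>I. w v choose k)"
    by (simp only: card_Sigma_subsets_of_size[OF finite.insertI[OF finite.emptyI]]) simp
  finally show ?thesis .
qed

text \<open>Every \<open>k\<close>-subset of the blow-up of one colour class is a clique, and
  different classes share none. Strictness comes from one further clique that meets two
  classes.\<close>

lemma num_cliques_blowup_clique_partition_less: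
  fixes c :: "'a \<Rightarrow> nat"
  assumes G: "simple_graph G" "finite (verts G)"
    and colour: "\<And>u v. u \<in> verts G \<Longrightarrow> v \<in> verts G \<Longrightarrow> c u = c v \<Longrightarrow> u \<noteq> v \<Longrightarrow> {u, v} \<in> edges G"
    and XY: "{X, Y} \<in> edges G" "c X \<noteq> c Y" "w X \<ge> 1" "w Y \<ge> k - 1" and k: "k \<ge> 2"
  shows "(\<Sum>i<r. (\<Sum>v\<in>{v \<in> verts G. c v = i}. w v) choose k) < num_cliques k (blowup G w)"
proof -
  let ?C = "\<lambda>i. {v \<in> verts G. c v = i}"
  let ?F = "\<lambda>i. {K. K \<subseteq> (SIGMA v:?C i. {..<w v}) \<and> card K = k}"
  let ?V = "SIGMA v:verts G. {..<w v}"
  have finV: "finite ?V"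
    using G(2) by auto
  have finF: "finite (?F i)" for i
    by (rule finite_subset[of _ "Pow ?V"]) (use finV in auto)
  have disj: "?F i \<inter> ?F j = {}" if "i \<noteq> j" for i j
  proof -
    have "False" if K: "K \<in> ?F i" "K \<in> ?F j" for K
    proof -
      have "K \<noteq> {}"
        using K(1) k by auto
      then show False
        using K \<open>i \<noteq> j\<close> by fastforce
    qed
    then show ?thesis
      by blast
  qed
  \<comment> \<open>One copy of \<open>X\<close> and \<open>k - 1\<close> copies of
    \<open>Y\<close>; the lower bounds on \<open>w X\<close> and \<open>w Y\<close> supply them, and
    \<open>k \<ge> 2\<close> ensures that \<open>Y\<close> really occurs.\<close>
  define K0 where "K0 = insert (X, 0) ({Y} \<times> {..<k - 1})"
  have XY_verts: "X \<in> verts G" "Y \<in> verts G" and "X \<noteq> Y"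
    using G(1) XY(1,2) by (auto simp: simple_graph_def)
  have K0: "is_clique k (blowup G w) K0"
    unfolding is_clique_blowup_iff[OF G(1)]
    using XY XY_verts \<open>X \<noteq> Y\<close> k by (auto simp: K0_def card_cartesian_product insert_commute)
  have K0_notin: "K0 \<notin> (\<Union>i<r. ?F i)"
  proof
    assume "K0 \<in> (\<Union>i<r. ?F i)"
    then obtain i where "K0 \<subseteq> (SIGMA v:?C i. {..<w v})"
      by blast
    moreover have "(X, 0) \<in> K0" "(Y, 0) \<in> K0"
      using k by (auto simp: K0_def)
    ultimately have "c X = i" "c Y = i"
      by blast+
    then show False
      using XY(2) by simp
  qed
  have "(\<Union>i<r. ?F i) \<subseteq> {K. is_clique k (blowup G w) K}"
  proof
    fix K assume "K \<in> (\<Union>i<r. ?F i)"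
    then obtain i where K: "K \<subseteq> (SIGMA v:?C i. {..<w v})" "card K = k"
      by blast
    have "finite K"
      using K(2) k card.infinite by fastforce
    moreover have "{fst x, fst y} \<in> edges G" if "x \<in> K" "y \<in> K" "fst x \<noteq> fst y" for x y
      using subsetD[OF K(1) that(1)] subsetD[OF K(1) that(2)] that(3) by (intro colour) auto
    ultimately show "K \<in> {K. is_clique k (blowup G w) K}"
      unfolding is_clique_blowup_iff[OF G(1)] using K by blast
  qed
  then have "(\<Union>i<r. ?F i) \<subset> {K. is_clique k (blowup G w) K}"
    using K0 K0_notin by blast
  moreover have "finite {K. is_clique k (blowup G w) K}"
    using finV by (intro finite_cliques) (simp add: blowup_def Let_def)
  ultimately have "card (\<Union>i<r. ?F i) < num_cliques k (blowup G w)"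
    unfolding num_cliques_def by (rule psubset_card_mono[rotated])
  also have "card (\<Union>i<r. ?F i) = (\<Sum>i<r. card (?F i))"
    using disj finF by (intro card_UN_disjoint) auto
  also have "\<dots> = (\<Sum>i<r. (\<Sum>v\<in>?C i. w v) choose k)"
    by (intro sum.cong refl card_Sigma_subsets_of_size) (use G(2) in auto)
  finally show ?thesis .
qed

section \<open>Convexity of binomial coefficients\<close>

text \<open>By Pascal's rule the left side is the line through the values at \<open>q\<close> and
  \<open>q + 1\<close>; convexity keeps it below the binomial at all naturals. Integers are needed
  because \<open>x\<close> may be smaller than \<open>q\<close>.\<close>

lemma binomial_above_secant:
  "int (q choose Suc k) + (int x - int q) * int (q choose k) \<le> int (x choose Suc k)"
proof (cases "q \<le> x")
  case True
  then show ?thesis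
  proof (induction x rule: dec_induct)
    case (step x)
    have "q choose k \<le> x choose k"
      using step.hyps(1) by (rule binomial_right_mono)
    then show ?case
      using step.IH by (simp add: algebra_simps)
  qed simp
next
  case False
  then have "x \<le> q"
    by simp
  then show ?thesis
  proof (induction q rule: dec_induct)
    case (step q)
    \<comment> \<open>To the left of the base point, moving the base point up makes the line steeper
      and so lowers its value at \<open>x\<close>.\<close>
    have "q choose k \<le> Suc q choose k"
      by (rule binomial_right_mono) simp
    then have "(int q + 1 - int x) * int (q choose k) \<le> (int q + 1 - int x) * int (Suc q choose k)"
      using step.hyps(1) by (intro mult_left_mono) auto
    then show ?case
      using step.IH by (simp add: algebra_simps)
  qed simp
qed

text \<open>The secant through \<open>q\<close> and \<open>q + 1\<close> is exact on the balanced
  weights and a lower bound on each \<open>W i\<close>, so both sums are compared with the same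
  linear expression in the common total.\<close>

lemma sum_binomial_balanced_le:
  fixes w :: "'a \<Rightarrow> nat" and W :: "nat \<Rightarrow> nat"
  assumes "k \<ge> 1" "finite I" "r \<le> card I"
    and balanced: "\<And>v. v \<in> I \<Longrightarrow> w v = q \<or> w v = q + 1"
    and total: "(\<Sum>v\<in>I. w v) = (\<Sum>i<r. W i)"
  shows "(\<Sum>v\<in>I. w v choose k) \<le> (\<Sum>i<r. W i choose k)"
proof -
  obtain l where k: "k = Suc l"
    using assms(1) by (cases k) auto
  let ?a = "int (card I)" and ?m = "int (\<Sum>i<r. W i)"
  let ?b = "int (q choose k)" and ?s = "int (q choose l)"
  have "int (w v choose k) = ?b + (int (w v) - int q) * ?s" if "v \<in> I" for v
    using balanced[OF that] by (auto simp: k)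
  then have "int (\<Sum>v\<in>I. w v choose k) = (\<Sum>v\<in>I. ?b + (int (w v) - int q) * ?s)"
    by simp
  also have "\<dots> = ?a * ?b + (int (\<Sum>v\<in>I. w v) - ?a * int q) * ?s"
    by (simp add: sum.distrib sum_subtractf flip: sum_distrib_right)
  also have "\<dots> = ?a * ?b + (?m - ?a * int q) * ?s"
    by (simp only: total)
  \<comment> \<open>The surplus of \<open>card I - r\<close> parts is split off; each contributes
    the value of the secant at 0, which is at most \<open>0 choose k = 0\<close>.\<close>
  also have "\<dots> = int r * ?b + (?m - int r * int q) * ?s + (?a - int r) * (?b + (0 - int q) * ?s)"
    by (simp add: algebra_simps)
  also have "\<dots> \<le> int r * ?b + (?m - int r * int q) * ?s"
  proof -
    have "?b + (0 - int q) * ?s \<le> 0"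
      using binomial_above_secant[of q l 0] by (simp add: k)
    then show ?thesis
      using assms(3) by (simp add: mult_nonneg_nonpos)
  qed
  also have "\<dots> = (\<Sum>i<r. ?b + (int (W i) - int q) * ?s)"
    by (simp add: sum.distrib sum_subtractf flip: sum_distrib_right)
  also have "\<dots> \<le> (\<Sum>i<r. int (W i choose k))"
    unfolding k by (intro sum_mono binomial_above_secant)
  finally show ?thesis
    by (simp flip: of_nat_sum)
qed

section \<open>Independent and clique independent sets of the Sperner graph\<close>

lemma edge_sperner_graph_iff:
  "{X, Y} \<in> edges (sperner_graph n) \<longleftrightarrow>
     X \<subseteq> {1..n} \<and> Y \<subseteq> {1..n} \<and> (X \<subset> Y \<or> Y \<subset> X)"
  by (auto simp: sperner_graph_def doubleton_eq_iff)

lemma finite_clique_independent_sets: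
  "finite (verts G) \<Longrightarrow> finite {I. clique_independent k G I}"
  by (rule finite_subset[of _ "Pow (verts G)"]) (auto simp: clique_independent_def)

lemma card_le_clique_alpha:
  "finite (verts G) \<Longrightarrow> clique_independent k G I \<Longrightarrow> card I \<le> clique_alpha k G"
  unfolding clique_alpha_def by (intro Max_ge) (auto intro: finite_clique_independent_sets)

lemma card_le_alpha:
  assumes "finite (verts G)" "independent_set G I"
  shows "card I \<le> alpha G"
proof -
  have "finite {I. independent_set G I}"
    by (rule finite_subset[of _ "Pow (verts G)"]) (use assms(1) in \<open>auto simp: independent_set_def\<close>)
  then show ?thesis
    unfolding alpha_def using assms(2) by (intro Max_ge) auto
qed

text \<open>A clique on at least three vertices still has two adjacent vertices after
  \<open>x\<close> is removed, and these would lie in \<open>U\<close>.\<close>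

lemma clique_independent_insert_independent_set:
  assumes "simple_graph G" "independent_set G U" "x \<in> verts G" "k \<ge> 3"
  shows "clique_independent k G (insert x U)"
  unfolding clique_independent_def
proof (intro conjI allI impI notI)
  show "insert x U \<subseteq> verts G"
    using assms(2,3) by (auto simp: independent_set_def)
next
  fix K assume K: "K \<subseteq> insert x U" "is_clique k G K"
  have "card (K - {x}) \<ge> 2"
    using K(2) assms(4) by (auto simp: is_clique_def card_Diff_singleton_if)
  moreover have "finite (K - {x})"
    using K(2) by (simp add: is_clique_def)
  ultimately have "\<not> (\<forall>y\<in>K - {x}. \<forall>z\<in>K - {x}. y = z)"
    using card_le_Suc0_iff_eq[of "K - {x}"] by linarith
  then obtain y z where "y \<in> K - {x}" "z \<in> K - {x}" "y \<noteq> z"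
    by blast
  then show False
    using K assms(2) unfolding is_clique_def independent_set_def by blast
qed

text \<open>The excluded pair is the one whose members are both fixed by every permutation of the
  ground set, so no transposition could separate it.\<close>

lemma clique_independent_sperner_graph_proper_edge:
  assumes "n \<ge> 2" "k \<ge> 3"
    and U: "clique_independent k (sperner_graph n) U" "card U = clique_alpha k (sperner_graph n)"
  obtains X Y where "X \<in> U" "Y \<in> U" "X \<subset> Y" "X \<noteq> {} \<or> Y \<noteq> {1..n}"
proof -
  let ?G = "sperner_graph n"
  have finG: "finite (verts ?G)"
    by (rule finite_verts_sperner_graph)
  have US: "U \<subseteq> Pow {1..n}"
    using U(1) by (simp add: clique_independent_def sperner_graph_def)
  have finU: "finite U"
    using US by (rule finite_subset) simp
  \<comment> \<open>If \<open>U\<close> were independent, any new vertex could be added against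
    maximality, so \<open>U\<close> would be the whole lattice, which has edges.\<close>
  have not_independent: "\<not> independent_set ?G U"
  proof
    assume ind: "independent_set ?G U"
    have "x \<in> U" if "x \<subseteq> {1..n}" for x
    proof (rule ccontr)
      assume "x \<notin> U"
      moreover have "clique_independent k ?G (insert x U)"
        using clique_independent_insert_independent_set[OF simple_graph_sperner_graph ind _ assms(2)] that
        by (simp add: sperner_graph_def)
      ultimately show False
        using card_le_clique_alpha[OF finG] U(2) finU by fastforce
    qed
    then have "{} \<in> U" "{1} \<in> U"
      using assms(1) by auto
    moreover have "{{}, {1}} \<in> edges ?G"
      using assms(1) by (auto simp: edge_sperner_graph_iff)
    ultimately show False
      using ind by (auto simp: independent_set_def)
  qed
  have "card U \<ge> 3"
  proof -
    have "independent_set ?G {{1}, {2}}"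
      using assms(1) unfolding independent_set_def edge_sperner_graph_iff
      by (auto simp: sperner_graph_def)
    then have "clique_independent k ?G {{}, {1}, {2}}"
      using clique_independent_insert_independent_set[OF simple_graph_sperner_graph _ _ assms(2)]
      by (simp add: sperner_graph_def)
    then show ?thesis
      using card_le_clique_alpha[OF finG] U(2) by fastforce
  qed
  have "\<exists>X\<in>U. \<exists>Y\<in>U. X \<subset> Y \<and> (X \<noteq> {} \<or> Y \<noteq> {1..n})"
  proof (rule ccontr)
    assume "\<not> ?thesis"
    then have only: "X = {} \<and> Y = {1..n}" if "X \<in> U" "Y \<in> U" "X \<subset> Y" for X Y
      using that by blast
    obtain X Y where "X \<in> U" "Y \<in> U" "X \<subset> Y"
      using not_independent US unfolding independent_set_def edge_sperner_graph_iff
      by (auto simp: sperner_graph_def)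
    \<comment> \<open>The empty set is comparable to every member of \<open>U\<close>, so a unique
      comparable pair leaves room for two members only, against
      \<open>card U \<ge> 3\<close>.\<close>
    then have E: "{} \<in> U"
      using only by blast
    have "Z = {} \<or> Z = {1..n}" if "Z \<in> U" for Z
      using only[OF E that] by blast
    then have "U \<subseteq> {{}, {1..n}}"
      by blast
    then have "card U \<le> card {{}, {1..n}}"
      by (intro card_mono) auto
    then show False
      using \<open>card U \<ge> 3\<close> by (auto simp: card_insert_if split: if_splits)
  qed
  then show thesis
    using that by blast
qed

section \<open>Separating a comparable pair by a transposition\<close>

text \<open>A transposition of the ground set acts on \<open>Pow S\<close> as an order automorphism,
  so pulling back along it keeps colour classes chains.\<close>

lemma chain_colouring_image_transpose:
  assumes "chain_colouring (Pow S) r c" "a \<in> S" "b \<in> S"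
  shows "chain_colouring (Pow S) r (\<lambda>X. c (transpose a b ` X))"
proof -
  have "transpose a b ` X \<in> Pow S" if "X \<in> Pow S" for X
    using that assms(2,3) by (auto simp: transpose_def)
  moreover have "transpose a b ` X \<subseteq> transpose a b ` Y \<longleftrightarrow> X \<subseteq> Y" for X Y
    by (simp add: inj_image_subset_iff)
  ultimately show ?thesis
    using assms(1) unfolding chain_colouring_def by metis
qed

lemma chain_colouring_separating:
  assumes c: "chain_colouring (Pow S) r c" and "finite S"
    and "X \<subset> Y" "Y \<subseteq> S" "X \<noteq> {} \<or> Y \<noteq> S"
  obtains d where "chain_colouring (Pow S) r d" "d X \<noteq> d Y"
proof (cases "c X = c Y")
  case False
  then show thesis
    by (rule that[OF c])
next
  case True
  obtain b where b: "b \<in> Y" "b \<notin> X"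
    using assms(3) by blast
  \<comment> \<open>The image has the same finite size as \<open>Z\<close> but differs from it, so
    the two are incomparable and cannot share a chain.\<close>
  have moved: "c (transpose a b ` Z) \<noteq> c Z"
    if a: "a \<in> S" and Z: "Z \<subseteq> S" "a \<in> Z \<longleftrightarrow> b \<notin> Z" for a Z
  proof
    assume eq: "c (transpose a b ` Z) = c Z"
    have "b \<in> S"
      using b assms(4) by blast
    then have "transpose a b ` Z \<in> Pow S"
      using a Z(1) by (auto simp: transpose_def)
    then have "transpose a b ` Z \<subseteq> Z \<or> Z \<subseteq> transpose a b ` Z"
      using c eq Z(1) unfolding chain_colouring_def by blast
    moreover have "card (transpose a b ` Z) = card Z"
      by (simp add: card_image inj_on_subset[OF inj_transpose])
    moreover have "finite Z"
      using Z(1) assms(2) by (rule finite_subset)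
    ultimately have "transpose a b ` Z = Z"
      by (metis card_subset_eq finite_imageI)
    then show False
      using Z(2) by (metis imageI transpose_apply_first transpose_apply_second)
  qed
  have fixed: "transpose a b ` Z = Z" if "a \<in> Z \<longleftrightarrow> b \<in> Z" for a Z
    using that by simp
  show thesis
  proof (cases "X = {}")
    \<comment> \<open>Here \<open>Y\<close> is not all of \<open>S\<close>; swapping
      \<open>b\<close> with a point outside \<open>Y\<close> fixes \<open>X\<close> and moves
      \<open>Y\<close>.\<close>
    case True
    then obtain a where a: "a \<in> S" "a \<notin> Y"
      using assms(4,5) by blast
    have "c (transpose a b ` X) \<noteq> c (transpose a b ` Y)"
    proof -
      have "transpose a b ` X = X"
        using a(2) b(2) assms(3) by (intro fixed) blast
      then show ?thesis
        using moved[of a Y] a b assms(4) \<open>c X = c Y\<close> by simp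
    qed
    then show thesis
      using b(1) a(1) assms(4) by (intro that[OF chain_colouring_image_transpose[OF c]]) auto
  next
    \<comment> \<open>Swapping \<open>b\<close> with a point of \<open>X\<close> fixes
      \<open>Y\<close> and moves \<open>X\<close>.\<close>
    case False
    then obtain a where a: "a \<in> X"
      by blast
    have "c (transpose a b ` X) \<noteq> c (transpose a b ` Y)"
    proof -
      have "transpose a b ` Y = Y"
        using a b(1) assms(3) by (intro fixed) blast
      moreover have "a \<in> S" "X \<subseteq> S"
        using a assms(3,4) by blast+
      ultimately show ?thesis
        using moved[of a X] a b \<open>c X = c Y\<close> by simp
    qed
    then show thesis
      using b(1) a assms(3,4) by (intro that[OF chain_colouring_image_transpose[OF c]]) auto
  qed
qed

section \<open>Uniform weightings and the final comparison\<close>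

text \<open>This puts uniformity into the form required by \<open>sum_binomial_balanced_le\<close>,
  with \<open>q = m div card U\<close>.\<close>

lemma uniform_on_values:
  assumes "uniform_on G m w U" "v \<in> U"
  shows "w v = m div card U \<or> w v = m div card U + 1"
proof -
  have fl: "\<lfloor>real m / real (card U)\<rfloor> = int (m div card U)"
    by (simp add: floor_divide_of_nat_eq)
  have "\<lceil>real m / real (card U)\<rceil> \<le> \<lfloor>real m / real (card U)\<rfloor> + 1"
    by linarith
  moreover have "\<lfloor>real m / real (card U)\<rfloor> \<le> \<lceil>real m / real (card U)\<rceil>"
    by (rule floor_le_ceiling)
  moreover have "int (w v) \<in> {\<lfloor>real m / real (card U)\<rfloor>, \<lceil>real m / real (card U)\<rceil>}"
    using assms by (simp add: uniform_on_def)
  ultimately show ?thesis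
    using fl by auto
qed

theorem theorem9:
  fixes n k m :: nat and w w' :: "nat set \<Rightarrow> nat" and U :: "nat set set"
  assumes "n \<ge> 2" and "k \<ge> 3"
    and "m \<ge> k * clique_alpha k (sperner_graph n)"
    and "weighting (sperner_graph n) m w"
    and "weighting (sperner_graph n) m w'"
    and "uniform_alpha (sperner_graph n) m w"
    and "clique_independent k (sperner_graph n) U"
    and "card U = clique_alpha k (sperner_graph n)"
    and "uniform_on (sperner_graph n) m w' U"
  shows "num_cliques k (blowup (sperner_graph n) w)
       < num_cliques k (blowup (sperner_graph n) w')"
proof -
  let ?G = "sperner_graph n"
  have finG: "finite (verts ?G)" and simpleG: "simple_graph ?G"
    by (rule finite_verts_sperner_graph, rule simple_graph_sperner_graph)
  have V: "verts ?G = Pow {1..n}"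
    by (simp add: sperner_graph_def)
  obtain I where I: "independent_set ?G I" "card I = alpha ?G" "uniform_on ?G m w I"
    using assms(6) by (auto simp: uniform_alpha_def)
  have IV: "I \<subseteq> verts ?G"
    using I(1) by (simp add: independent_set_def)
  have finI: "finite I"
    using IV finG by (rule finite_subset)
  have zero: "\<forall>v\<in>verts ?G - I. w v = 0"
    using I(3) by (simp add: uniform_on_def)
  obtain X Y where XY: "X \<in> U" "Y \<in> U" "X \<subset> Y" "X \<noteq> {} \<or> Y \<noteq> {1..n}"
    using clique_independent_sperner_graph_proper_edge[OF assms(1,2,7,8)] .
  have UV: "U \<subseteq> Pow {1..n}"
    using assms(7) by (simp add: clique_independent_def V)
  \<comment> \<open>The lower bound on \<open>m\<close> makes the average weight on \<open>U\<close>
    at least \<open>k\<close>, enough copies of \<open>X\<close> and \<open>Y\<close> for a clique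
    meeting both.\<close>
  have w'_ge: "w' u \<ge> k" if "u \<in> U" for u
  proof -
    have "card U > 0"
      using that UV by (auto simp: card_gt_0_iff intro: finite_subset)
    then have "k \<le> m div card U"
      using assms(3,8) by (simp add: less_eq_div_iff_mult_less_eq)
    then show ?thesis
      using uniform_on_values[OF assms(9) that] by auto
  qed
  obtain A c0 where A: "antichain_in (Pow {1..n}) A" and c0: "chain_colouring (Pow {1..n}) (card A) c0"
    using dilworth[of "Pow {1..n}"] by auto
  obtain c where c: "chain_colouring (Pow {1..n}) (card A) c" "c X \<noteq> c Y"
    using chain_colouring_separating[OF c0 _ XY(3) _ XY(4)] XY(2) UV by auto
  let ?W = "\<lambda>i. \<Sum>v\<in>{v \<in> verts ?G. c v = i}. w' v"
  \<comment> \<open>Only the inequality \<open>card A \<le> alpha ?G\<close> is derived; the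
    balancing lemma allows fewer chains than vertices of \<open>I\<close>.\<close>
  have "independent_set ?G A"
    using A unfolding independent_set_def antichain_in_def edge_sperner_graph_iff V by blast
  then have r_le: "card A \<le> card I"
    using card_le_alpha[OF finG] I(2) by simp
  \<comment> \<open>Both weightings have total \<open>m\<close>: the first is supported on
    \<open>I\<close>, the second is grouped by chains.\<close>
  have "(\<Sum>v\<in>I. w v) = (\<Sum>v\<in>verts ?G. w v)"
    using IV finG zero by (intro sum.mono_neutral_left) auto
  also have "\<dots> = (\<Sum>v\<in>verts ?G. w' v)"
    using assms(4,5) by (simp add: weighting_def)
  also have "\<dots> = (\<Sum>i<card A. ?W i)"
    using c(1) finG by (intro sum.group[symmetric]) (auto simp: chain_colouring_def V)
  finally have total: "(\<Sum>v\<in>I. w v) = (\<Sum>i<card A. ?W i)" .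
  have "num_cliques k (blowup ?G w) \<le> (\<Sum>v\<in>I. w v choose k)"
    using num_cliques_blowup_independent_le[OF simpleG finG I(1) zero] assms(2) by simp
  also have "\<dots> \<le> (\<Sum>i<card A. ?W i choose k)"
    using assms(2) by (intro sum_binomial_balanced_le[OF _ finI r_le uniform_on_values[OF I(3)] total]) auto
  also have "\<dots> < num_cliques k (blowup ?G w')"
  proof (rule num_cliques_blowup_clique_partition_less[OF simpleG finG])
    show "{u, v} \<in> edges ?G" if "u \<in> verts ?G" "v \<in> verts ?G" "c u = c v" "u \<noteq> v" for u v
      using that c(1) unfolding chain_colouring_def edge_sperner_graph_iff V by blast
    show "{X, Y} \<in> edges ?G"
      using XY UV unfolding edge_sperner_graph_iff by blast
    show "c X \<noteq> c Y"
      by (rule c(2))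
    show "w' X \<ge> 1" "w' Y \<ge> k - 1" "k \<ge> 2"
      using w'_ge[OF XY(1)] w'_ge[OF XY(2)] assms(2) by linarith+
  qed
  finally show ?thesis .
qed

end
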